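(* Let $n\ge 3$ and let $M$ be a perfect matching in the complete graph $K_{2n}$. If $G=K_{2n}-M$ is the graph obtained from $K_{2n}$ by deleting the edges of $M$, then $\gamma_{MR}(G)=0$.
   Context: All graphs are finite and simple. For a vertex $v$ of $G=(V,E)$, $N[v]=\{v\}\cup\{u: uv\in E\}$ is the closed neighborhood, and for $f:V\to\mathbb{R}$ and $S\subseteq V$, $f(S)=\sum_{x\in S}f(x)$. A majority Roman dominating function (MRDF) on $G$ is a function $f:V\to\{-1,1,2\}$ such that (i) $f(N[v])\ge 1$ for at least half of the vertices $v\in V$, and (ii) every vertex $u$ with $f(u)=-1$ is adjacent to at least one vertex $w$ with $f(w)=2$. The weight of $f$ is $f(V)$, and the majority Roman domination number $\gamma_{MR}(G)$ is the minimum weight of an MRDF on $G$. *)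

theory Defs
  imports Main
begin

text \<open>A graph is given by its vertex set and its set of edges, an edge being the set of its two
  end vertices.\<close>

definition simple_graph :: "'a set \<Rightarrow> 'a set set \<Rightarrow> bool" where
  "simple_graph V E \<longleftrightarrow> finite V \<and> (\<forall>e\<in>E. e \<subseteq> V \<and> card e = 2)"

definition adjacent :: "'a set set \<Rightarrow> 'a \<Rightarrow> 'a \<Rightarrow> bool" where
  "adjacent E u v \<longleftrightarrow> {u, v} \<in> E"

definition closed_neighborhood :: "'a set \<Rightarrow> 'a set set \<Rightarrow> 'a \<Rightarrow> 'a set" where
  "closed_neighborhood V E v = {v} \<union> {u \<in> V. adjacent E u v}"

definition complete_edges :: "'a set \<Rightarrow> 'a set set" where
  "complete_edges V = {e. e \<subseteq> V \<and> card e = 2}"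

definition perfect_matching :: "'a set \<Rightarrow> 'a set set \<Rightarrow> 'a set set \<Rightarrow> bool" where
  "perfect_matching V E M \<longleftrightarrow> M \<subseteq> E \<and> (\<forall>v\<in>V. \<exists>!e. e \<in> M \<and> v \<in> e)"

text \<open>Only the values of \<open>f\<close> on \<open>V\<close> matter. The second conjunct says that at least half of the
  vertices \<open>v\<close> satisfy \<open>f(N[v]) \<ge> 1\<close>.\<close>

definition MRDF :: "'a set \<Rightarrow> 'a set set \<Rightarrow> ('a \<Rightarrow> int) \<Rightarrow> bool" where
  "MRDF V E f \<longleftrightarrow>
     f ` V \<subseteq> {-1, 1, 2} \<and>
     card V \<le> 2 * card {v \<in> V. sum f (closed_neighborhood V E v) \<ge> 1} \<and>
     (\<forall>u\<in>V. f u = -1 \<longrightarrow> (\<exists>w\<in>V. adjacent E u w \<and> f w = 2))"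

definition gamma_MR :: "'a set \<Rightarrow> 'a set set \<Rightarrow> int" where
  "gamma_MR V E = Min {sum f V | f. MRDF V E f}"

text \<open>The minimum is taken over a finite nonempty set.\<close>

lemma MRDF_weights_finite:
  assumes "simple_graph V E"
  shows "finite {sum f V | f. MRDF V E f}"
proof (rule finite_subset)
  show "{sum f V | f. MRDF V E f} \<subseteq> {- int (card V) .. 2 * int (card V)}"
  proof clarsimp
    fix f assume "MRDF V E f"
    then have b: "-1 \<le> f v \<and> f v \<le> 2" if "v \<in> V" for v
      using that by (auto simp: MRDF_def)
    show "- int (card V) \<le> sum f V \<and> sum f V \<le> 2 * int (card V)"
      using sum_bounded_below[of V "-1" f] sum_bounded_above[of V f 2] b by auto
  qed
qed simp

lemma MRDF_weights_nonempty:
  assumes "simple_graph V E"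
  shows "{sum f V | f. MRDF V E f} \<noteq> {}"
proof -
  have "1 \<le> card (closed_neighborhood V E v)" if "v \<in> V" for v
    using assms that
    by (auto simp: closed_neighborhood_def simple_graph_def Suc_le_eq card_gt_0_iff)
  then have "{v \<in> V. (\<Sum>u\<in>closed_neighborhood V E v. 1::int) \<ge> 1} = V"
    by auto
  then have "MRDF V E (\<lambda>_. 1)"
    unfolding MRDF_def by auto
  then show ?thesis by blast
qed

lemma simple_graph_complete_minus:
  assumes "finite V"
  shows "simple_graph V (complete_edges V - M)"
  using assms by (auto simp: simple_graph_def complete_edges_def)

end

theory Submission
  imports Defs
begin

text \<open>In \<open>K\<^sub>2\<^sub>n - M\<close> the closed neighbourhood of \<open>v\<close> misses only the partner \<open>m v\<close> of \<open>v\<close> in \<open>M\<close>, so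
  \<open>f(N[v]) = f(V) - f(m v)\<close>. If \<open>f(V) < 0\<close> this is never positive, since \<open>f \<ge> -1\<close>. If \<open>f(V) = 0\<close>
  it is positive exactly when \<open>f(m v) = -1\<close>. An MRDF of weight \<open>0\<close> therefore arises from
  \<open>n + 1\<close> vertices of value \<open>-1\<close>, two of value \<open>2\<close> and \<open>n - 3\<close> of value \<open>1\<close>; every vertex of
  value \<open>-1\<close> is adjacent to at least one of the two vertices of value \<open>2\<close>.\<close>

text \<open>The one edge of \<open>M\<close> at \<open>v\<close> has exactly two ends, and
  \<open>m v\<close> is the other one. This turns the matching into a fixed-point-free involution,
  so that non-adjacency becomes an equation.\<close>

lemma perfect_matching_partner:
  assumes "perfect_matching V (complete_edges V) M"
  obtains m where "\<And>v u. v \<in> V \<Longrightarrow> {u, v} \<in> M \<longleftrightarrow> u = m v"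
    and "\<And>v. v \<in> V \<Longrightarrow> m v \<in> V" and "\<And>v. v \<in> V \<Longrightarrow> m v \<noteq> v"
    and "\<And>v. v \<in> V \<Longrightarrow> m (m v) = v"
proof -
  have edge: "e \<subseteq> V" "card e = 2" if "e \<in> M" for e
    using assms that by (auto simp: perfect_matching_def complete_edges_def)
  have uniq: "\<exists>!e. e \<in> M \<and> v \<in> e" if "v \<in> V" for v
    using assms that by (auto simp: perfect_matching_def)
  have "\<exists>!u. {u, v} \<in> M" if v: "v \<in> V" for v
  proof -
    obtain e where e: "e \<in> M" "v \<in> e"
      using uniq[OF v] by blast
    then obtain u where "e = {u, v}"
      using edge(2)[OF e(1)] by (auto simp: card_2_iff)
    moreover have "u' = u''" if "{u', v} \<in> M" "{u'', v} \<in> M" for u' u''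
    proof -
      have "{u', v} = {u'', v}" using uniq[OF v] that by blast
      then show ?thesis by (auto simp: doubleton_eq_iff)
    qed
    ultimately show ?thesis using e(1) by blast
  qed
  then obtain m where m: "\<And>v u. v \<in> V \<Longrightarrow> {u, v} \<in> M \<longleftrightarrow> u = m v"
    by metis
  have mV: "m v \<in> V" if "v \<in> V" for v
    using edge(1)[of "{m v, v}"] m[OF that] by blast
  moreover have "m v \<noteq> v" if "v \<in> V" for v
    using edge(2)[of "{m v, v}"] m[OF that] by auto
  \<comment> \<open>The edge \<open>{m v, v}\<close>, read from its end \<open>m v\<close>, names
    \<open>v\<close> as the partner.\<close>
  moreover have "m (m v) = v" if "v \<in> V" for v
    using m[OF that, of "m v"] m[OF mV[OF that], of v] by (simp add: insert_commute)
  ultimately show thesis using m that by blast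
qed

lemma MRDF_positive_vertex:
  assumes "MRDF V E f" and "finite V" and "V \<noteq> {}"
  obtains v where "v \<in> V" and "sum f (closed_neighborhood V E v) \<ge> 1"
proof -
  have "card {v \<in> V. sum f (closed_neighborhood V E v) \<ge> 1} > 0"
    using assms card_gt_0_iff[of V] unfolding MRDF_def by linarith
  then have "{v \<in> V. sum f (closed_neighborhood V E v) \<ge> 1} \<noteq> {}"
    using card_gt_0_iff by blast
  then show thesis using that by blast
qed

theorem proposition9:
  fixes n :: nat and V :: "'a set" and M :: "'a set set"
  assumes "n \<ge> 3"
    and "finite V" and "card V = 2 * n"
    and "perfect_matching V (complete_edges V) M"
  shows "gamma_MR V (complete_edges V - M) = 0"
proof -
  let ?E = "complete_edges V - M"
  obtain m where m: "\<And>v u. v \<in> V \<Longrightarrow> {u, v} \<in> M \<longleftrightarrow> u = m v"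
    and mV: "\<And>v. v \<in> V \<Longrightarrow> m v \<in> V" and mne: "\<And>v. v \<in> V \<Longrightarrow> m v \<noteq> v"
    and mm: "\<And>v. v \<in> V \<Longrightarrow> m (m v) = v"
    using perfect_matching_partner[OF assms(4)] by blast
  have adj: "adjacent ?E u v \<longleftrightarrow> u \<noteq> v \<and> u \<noteq> m v" if "u \<in> V" "v \<in> V" for u v
    using that m[OF that(2)] by (simp add: adjacent_def complete_edges_def card_insert_if)
  have N: "closed_neighborhood V ?E v = V - {m v}" if "v \<in> V" for v
    using that adj mne[OF that] by (auto simp: closed_neighborhood_def)
  have fN: "sum f (closed_neighborhood V ?E v) = sum f V - f (m v)"
    if "v \<in> V" for v and f :: "'a \<Rightarrow> int"
    using that mV assms(2) by (simp add: N sum_diff1)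
  have lower: "0 \<le> sum f V" if f: "MRDF V ?E f" for f
  proof -
    have "V \<noteq> {}" using assms(1,3) by auto
    then obtain v where v: "v \<in> V" "sum f (closed_neighborhood V ?E v) \<ge> 1"
      using MRDF_positive_vertex[OF f assms(2)] by blast
    \<comment> \<open>By \<open>fN\<close>, \<open>sum f V\<close> is at least
      \<open>1 + f (m v)\<close>.\<close>
    have "f (m v) \<ge> -1" using f mV[OF v(1)] by (auto simp: MRDF_def)
    then show ?thesis using v fN by simp
  qed
  \<comment> \<open>With two values 2 and a values -1 the weight is 2n + 2 - 2a, which vanishes only
    for a = n + 1.\<close>
  obtain A where A: "A \<subseteq> V" "card A = n + 1"
    using obtain_subset_with_card_n[of "n + 1" V] assms(1,3) by auto
  have finA: "finite A" using A(1) assms(2) by (rule finite_subset)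
  have cVA: "card (V - A) = n - 1"
    using A assms(3) finA by (simp add: card_Diff_subset)
  \<comment> \<open>Here n \<ge> 3 leaves room outside \<open>A\<close> for two vertices of value
    2.\<close>
  then have "2 \<le> card (V - A)" using assms(1) by simp
  then obtain B where B: "B \<subseteq> V - A" "card B = 2"
    by (rule obtain_subset_with_card_n)
  have finB: "finite B" using B(1) assms(2) finite_subset by blast
  define f :: "'a \<Rightarrow> int" where "f v = (if v \<in> A then -1 else if v \<in> B then 2 else 1)" for v
  have "sum f V = sum f (V - A - B) + sum f B + sum f A"
    using A(1) B(1) assms(2) by (simp add: sum.subset_diff)
  also have "sum f (V - A - B) = (\<Sum>v\<in>V - A - B. 1)"
    by (rule sum.cong) (auto simp: f_def)
  also have "\<dots> = int n - 3"
    using cVA B finB assms(1) by (simp add: card_Diff_subset)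
  also have "sum f B = (\<Sum>v\<in>B. 2)"
    using B(1) by (intro sum.cong) (auto simp: f_def)
  also have "sum f A = (\<Sum>v\<in>A. -1)"
    by (rule sum.cong) (auto simp: f_def)
  finally have sum0: "sum f V = 0"
    using A(2) B(2) by simp
  have "MRDF V ?E f"
    unfolding MRDF_def
  proof (intro conjI ballI impI)
    show "f ` V \<subseteq> {-1, 1, 2}" by (auto simp: f_def)
    \<comment> \<open>The neighborhood of \<open>m a\<close> misses only \<open>a\<close>, so its
      sum is 0 - (-1) = 1.\<close>
    have "m ` A \<subseteq> {v \<in> V. sum f (closed_neighborhood V ?E v) \<ge> 1}"
    proof (rule image_subsetI)
      fix a assume "a \<in> A"
      then have "a \<in> V" "f a = -1" using A(1) by (auto simp: f_def)
      then show "m a \<in> {v \<in> V. sum f (closed_neighborhood V ?E v) \<ge> 1}"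
        using fN[OF mV, of a f] by (simp add: sum0 mV mm)
    qed
    then have "card (m ` A) \<le> card {v \<in> V. sum f (closed_neighborhood V ?E v) \<ge> 1}"
      using assms(2) by (intro card_mono) auto
    moreover have "inj_on m A"
      using A(1) mm by (intro inj_on_inverseI[where g = m]) blast
    then have "card (m ` A) = n + 1"
      using A(2) by (simp add: card_image)
    ultimately show "card V \<le> 2 * card {v \<in> V. sum f (closed_neighborhood V ?E v) \<ge> 1}"
      using assms(3) by linarith
  next
    fix u assume u: "u \<in> V" "f u = -1"
    then have "u \<in> A" by (auto simp: f_def split: if_splits)
    obtain x y where xy: "B = {x, y}" "x \<noteq> y" using B(2) by (auto simp: card_2_iff)
    \<comment> \<open>As \<open>m\<close> is injective on \<open>V\<close>, \<open>u\<close> is the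
      partner of at most one of \<open>x\<close> and \<open>y\<close>; the other one serves as
      \<open>w\<close>.\<close>
    have "m x \<noteq> m y"
      using xy mm[of x] mm[of y] B(1) by auto
    then obtain w where w: "w \<in> B" "u \<noteq> m w"
      using xy(1) by blast
    then have "w \<in> V" "f w = 2" "u \<noteq> w"
      using B(1) \<open>u \<in> A\<close> by (auto simp: f_def)
    then show "\<exists>w\<in>V. adjacent ?E u w \<and> f w = 2"
      using adj u(1) w(2) by blast
  qed
  then have "0 \<in> {sum f V | f. MRDF V ?E f}"
    using sum0 by force
  then show ?thesis
    unfolding gamma_MR_def
    using lower MRDF_weights_finite[OF simple_graph_complete_minus[OF assms(2)]]
    by (intro Min_eqI) auto
qed

end
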